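(* For any group $G$ and any integer $n\ge1$, the commutator subgroup of $G\wr_n\mathbb{Z}$ is $$\left[G\wr_n\mathbb{Z},\,G\wr_n\mathbb{Z}\right]=\left\{(g_1,g_2,\dots,g_n,0)\ \Big|\ \prod_{i=1}^n g_i\in[G,G]\right\}.$$
   Context: For a group $G$ and $n\ge 1$, $G\wr_n\mathbb{Z}$ is the semidirect product $G^n\rtimes\mathbb{Z}$ with respect to the action of $\mathbb{Z}$ on $G^n$ by cyclic shifts of coordinates. Its elements are written $(g_1,\dots,g_n,k)$ with $g_i\in G$, $k\in\mathbb{Z}$, and the multiplication is $(a_1,\dots,a_n,k)(b_1,\dots,b_n,p)=(a_{1+p}b_1,a_{2+p}b_2,\dots,a_{n+p}b_n,k+p)$, indices taken modulo $n$. $[H,H]$ denotes the commutator subgroup of a group $H$. *)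

theory Defs
  imports "HOL-Algebra.Algebra"
begin

(* The representative in {1..n} of the residue class of j modulo n. *)
definition cyclic_index :: "nat \<Rightarrow> int \<Rightarrow> nat" where
  "cyclic_index n j = Suc (nat ((j - 1) mod int n))"

definition cyclic_shift :: "nat \<Rightarrow> int \<Rightarrow> (nat \<Rightarrow> 'a) \<Rightarrow> nat \<Rightarrow> 'a" where
  "cyclic_shift n p a = (\<lambda>i\<in>{1..n}. a (cyclic_index n (int i + p)))"

abbreviation power_group :: "('a, 'b) monoid_scheme \<Rightarrow> nat \<Rightarrow> (nat \<Rightarrow> 'a) monoid" where
  "power_group G n \<equiv> product_group {1..n} (\<lambda>_. G)"

(* The element (g_1, ..., g_n, k) is the pair (g, k), where g is undefined outside {1..n}. *)
definition cyclic_wreath :: "('a, 'b) monoid_scheme \<Rightarrow> nat \<Rightarrow> ((nat \<Rightarrow> 'a) \<times> int) monoid" where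
  "cyclic_wreath G n =
    \<lparr>carrier = carrier (power_group G n) \<times> carrier integer_group,
     monoid.mult = (\<lambda>(a, k) (b, p).
       (cyclic_shift n p a \<otimes>\<^bsub>power_group G n\<^esub> b, k \<otimes>\<^bsub>integer_group\<^esub> p)),
     one = (\<one>\<^bsub>power_group G n\<^esub>, \<one>\<^bsub>integer_group\<^esub>)\<rparr>"

(* The product g_1 g_2 ... g_n in this order; finprod needs commutativity. *)
definition ordered_prod :: "('a, 'b) monoid_scheme \<Rightarrow> nat \<Rightarrow> (nat \<Rightarrow> 'a) \<Rightarrow> 'a" where
  "ordered_prod G n g = foldr (\<otimes>\<^bsub>G\<^esub>) (map g [1..<Suc n]) \<one>\<^bsub>G\<^esub>"

abbreviation commutator_subgroup :: "('a, 'b) monoid_scheme \<Rightarrow> 'a set" where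
  "commutator_subgroup H \<equiv> derived H (carrier H)"

lemma cyclic_index_in: "n \<ge> 1 \<Longrightarrow> cyclic_index n j \<in> {1..n}"
  using pos_mod_bound[of "int n" "j - 1"] pos_mod_sign[of "int n" "j - 1"]
  by (auto simp: cyclic_index_def Suc_le_eq nat_less_iff)

lemma cyclic_index_id: "i \<in> {1..n} \<Longrightarrow> cyclic_index n (int i) = i"
  by (auto simp: cyclic_index_def)

lemma cyclic_index_add:
  "n \<ge> 1 \<Longrightarrow> cyclic_index n (int (cyclic_index n j) + p) = cyclic_index n (j + p)"
  by (simp add: cyclic_index_def mod_simps algebra_simps)

lemma cyclic_wreath_mult:
  "(a, k) \<otimes>\<^bsub>cyclic_wreath G n\<^esub> (b, p) =
    ((\<lambda>i\<in>{1..n}. a (cyclic_index n (int i + p)) \<otimes>\<^bsub>G\<^esub> b i), k + p)"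
  by (auto simp: cyclic_wreath_def cyclic_shift_def)

lemma cyclic_wreath_carrier:
  "carrier (cyclic_wreath G n) = ({1..n} \<rightarrow>\<^sub>E carrier G) \<times> UNIV"
  by (simp add: cyclic_wreath_def)

lemma cyclic_wreath_one: "\<one>\<^bsub>cyclic_wreath G n\<^esub> = (\<lambda>i\<in>{1..n}. \<one>\<^bsub>G\<^esub>, 0)"
  by (simp add: cyclic_wreath_def)

lemma group_cyclic_wreath:
  fixes G (structure)
  assumes "group G" and n: "n \<ge> 1"
  shows "group (cyclic_wreath G n)"
proof -
  interpret group G by fact
  note idx = cyclic_index_in[OF n]
  show ?thesis
  proof (rule groupI)
    fix x y assume "x \<in> carrier (cyclic_wreath G n)" "y \<in> carrier (cyclic_wreath G n)"
    then show "x \<otimes>\<^bsub>cyclic_wreath G n\<^esub> y \<in> carrier (cyclic_wreath G n)"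
      using idx by (cases x; cases y) (auto simp: cyclic_wreath_mult cyclic_wreath_carrier PiE_iff)
  next
    show "\<one>\<^bsub>cyclic_wreath G n\<^esub> \<in> carrier (cyclic_wreath G n)"
      by (simp add: cyclic_wreath_one cyclic_wreath_carrier)
  next
    fix x y z
    assume "x \<in> carrier (cyclic_wreath G n)" "y \<in> carrier (cyclic_wreath G n)"
      "z \<in> carrier (cyclic_wreath G n)"
    moreover obtain a k b p c q where "x = (a, k)" "y = (b, p)" "z = (c, q)"
      by (metis surj_pair)
    moreover have "cyclic_index n (int (cyclic_index n (int i + q)) + p)
        = cyclic_index n (int i + (p + q))" for i
      using cyclic_index_add[OF n, of "int i + q" p] by (simp add: add_ac)
    ultimately show "x \<otimes>\<^bsub>cyclic_wreath G n\<^esub> y \<otimes>\<^bsub>cyclic_wreath G n\<^esub> z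
        = x \<otimes>\<^bsub>cyclic_wreath G n\<^esub> (y \<otimes>\<^bsub>cyclic_wreath G n\<^esub> z)"
      using idx
      by (auto simp: cyclic_wreath_mult cyclic_wreath_carrier PiE_iff m_assoc restrict_def fun_eq_iff
          simp del: atLeastAtMost_iff)
  next
    fix x assume "x \<in> carrier (cyclic_wreath G n)"
    then show "\<one>\<^bsub>cyclic_wreath G n\<^esub> \<otimes>\<^bsub>cyclic_wreath G n\<^esub> x = x"
      using idx
      by (cases x) (auto simp: cyclic_wreath_mult cyclic_wreath_carrier cyclic_wreath_one PiE_iff
          restrict_def fun_eq_iff extensional_def simp del: atLeastAtMost_iff)
  next
    fix x assume x: "x \<in> carrier (cyclic_wreath G n)"
    obtain a k where [simp]: "x = (a, k)" by (cases x)
    define b where "b = (\<lambda>i\<in>{1..n}. inv a (cyclic_index n (int i - k)))"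
    have a: "a i \<in> carrier G" if "i \<in> {1..n}" for i
      using x that by (auto simp: cyclic_wreath_carrier)
    have "b (cyclic_index n (int i + k)) \<otimes> a i = \<one>" if "i \<in> {1..n}" for i
      using a[OF that] idx[of "int i + k"] cyclic_index_add[OF n, of "int i + k" "- k"]
        cyclic_index_id[OF that] by (simp add: b_def del: atLeastAtMost_iff)
    then have "(b, - k) \<otimes>\<^bsub>cyclic_wreath G n\<^esub> x = \<one>\<^bsub>cyclic_wreath G n\<^esub>"
      by (auto simp: cyclic_wreath_mult cyclic_wreath_one simp del: atLeastAtMost_iff)
    moreover have "(b, - k) \<in> carrier (cyclic_wreath G n)"
      using a idx by (auto simp: cyclic_wreath_carrier b_def simp del: atLeastAtMost_iff)
    ultimately show "\<exists>y\<in>carrier (cyclic_wreath G n).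
        y \<otimes>\<^bsub>cyclic_wreath G n\<^esub> x = \<one>\<^bsub>cyclic_wreath G n\<^esub>" by blast
  qed
qed

end

(* The product map (g, k) |-> g_1 ... g_n mod [G, G] is a homomorphism of the wreath product onto an
   abelian group, because there the cyclic shifts only permute the factors; together with the
   projection (g, k) |-> k it bounds the commutator subgroup from above. Conversely, conjugation by
   powers of the shift moves the embedded copy of x in coordinate i to coordinate 1, so in the
   abelianization (g, 0) equals the first-coordinate copy of g_1 ... g_n, which is trivial as soon
   as g_1 ... g_n lies in [G, G]. *)
theory Submission
  imports Defs
begin

text \<open>A subgroup is the coset of exactly its own elements. This moves membership in a
  commutator subgroup to the abelianization, for \<open>G\<close> in one inclusion and for the
  wreath product in the other.\<close>

lemma (in group) coset_derived_eq_one_iff: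
  assumes "x \<in> carrier G"
  shows "derived G (carrier G) #> x = \<one>\<^bsub>G Mod derived G (carrier G)\<^esub> \<longleftrightarrow>
    x \<in> derived G (carrier G)"
proof -
  have D: "subgroup (derived G (carrier G)) G"
    by (rule derived_is_subgroup) simp
  then show ?thesis
    using coset_join1[OF _ assms D] coset_join2[OF assms D] subgroup.subset[OF D]
    by auto
qed

text \<open>The image of the derived subgroup is the derived subgroup of the image, which is trivial
  in a commutative group.\<close>

lemma (in group) hom_comm_group_derived:
  assumes "h \<in> hom G A" "comm_group A" "x \<in> derived G (carrier G)"
  shows "h x = \<one>\<^bsub>A\<^esub>"
proof -
  interpret A: comm_group A by fact
  interpret group_hom G A h
    using assms(1) by unfold_locales
  have "h ` derived G (carrier G) = {\<one>\<^bsub>A\<^esub>}"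
    using derived_img[of "carrier G"] A.derived_eq_singleton[of "h ` carrier G"] hom_closed
    by (simp add: image_subset_iff)
  then show ?thesis using assms(3) by blast
qed

lemma (in group) foldr_mult_closed:
  "set xs \<subseteq> carrier G \<Longrightarrow> foldr (\<otimes>) xs \<one> \<in> carrier G"
  by (induction xs) auto

lemma (in group) ordered_prod_closed:
  "g \<in> {1..n} \<rightarrow> carrier G \<Longrightarrow> ordered_prod G n g \<in> carrier G"
  unfolding ordered_prod_def by (rule foldr_mult_closed) auto

text \<open>In a commutative target the order of the factors is irrelevant, so the
  \<open>foldr\<close> turns into a \<open>finprod\<close>, which can be split and
  reindexed.\<close>

lemma (in group) hom_ordered_prod:
  assumes "h \<in> hom G A" "comm_group A" "g \<in> {1..n} \<rightarrow> carrier G"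
  shows "h (ordered_prod G n g) = finprod A (\<lambda>i. h (g i)) {1..n}"
proof -
  interpret A: comm_group A by fact
  interpret group_hom G A h
    using assms(1) by unfold_locales
  \<comment> \<open>Generalized to distinct lists for the induction: distinctness makes the head a
    new index, so \<open>finprod\<close> gains exactly one factor.\<close>
  have "h (foldr (\<otimes>) (map g xs) \<one>) = finprod A (\<lambda>i. h (g i)) (set xs)"
    if "distinct xs" "g \<in> set xs \<rightarrow> carrier G" for xs
    using that
  proof (induction xs)
    case (Cons x xs)
    then have "foldr (\<otimes>) (map g xs) \<one> \<in> carrier G"
      by (intro foldr_mult_closed) auto
    with Cons show ?case
      by (auto simp: Pi_iff)
  qed simp
  from this[of "[1..<Suc n]"] assms(3) show ?thesis
    by (simp add: ordered_prod_def atLeastLessThanSuc_atLeastAtMost del: upt_Suc)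
qed

text \<open>Shifting back by \<open>- p\<close> is the inverse map, so a shift merely permutes the
  indices of a product.\<close>

lemma bij_betw_cyclic_index:
  assumes n: "n \<ge> 1"
  shows "bij_betw (\<lambda>i. cyclic_index n (int i + p)) {1..n} {1..n}"
proof (rule bij_betw_byWitness[where f' = "\<lambda>i. cyclic_index n (int i + - p)"])
  show "\<forall>i\<in>{1..n}. cyclic_index n (int (cyclic_index n (int i + p)) + - p) = i"
    by (metis cyclic_index_add[OF n] cyclic_index_id add.right_neutral add.assoc add.right_inverse)
  show "\<forall>i\<in>{1..n}. cyclic_index n (int (cyclic_index n (int i + - p)) + p) = i"
    by (metis cyclic_index_add[OF n] cyclic_index_id add.right_neutral add.assoc add.left_inverse)
qed (use cyclic_index_in[OF n] in auto)

definition wreath_prod_class :: "('a, 'b) monoid_scheme \<Rightarrow> nat \<Rightarrow> (nat \<Rightarrow> 'a) \<times> int \<Rightarrow> 'a set" where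
  "wreath_prod_class G n x = derived G (carrier G) #>\<^bsub>G\<^esub> ordered_prod G n (fst x)"

text \<open>In the abelianization of \<open>G\<close> the product over the coordinates of
  \<open>x\<close> times \<open>y\<close> splits into two products, and the shift that
  \<open>y\<close> causes in the first one is undone by reindexing.\<close>

lemma (in group) wreath_prod_class_hom:
  assumes n: "n \<ge> 1"
  shows "wreath_prod_class G n \<in> hom (cyclic_wreath G n) (G Mod derived G (carrier G))"
proof -
  let ?A = "G Mod derived G (carrier G)"
  let ?\<pi> = "\<lambda>x. derived G (carrier G) #> x"
  interpret A: comm_group ?A by (rule derived_quot_is_comm_group)
  have \<pi>: "?\<pi> \<in> hom G ?A"
    by (rule normal.r_coset_hom_Mod[OF derived_self_is_normal])
  have \<pi>_closed: "?\<pi> x \<in> carrier ?A" if "x \<in> carrier G" for x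
    using \<pi> that by (rule hom_in_carrier)
  have prod: "?\<pi> (ordered_prod G n g) = finprod ?A (\<lambda>i. ?\<pi> (g i)) {1..n}"
    if "g \<in> {1..n} \<rightarrow> carrier G" for g
    by (rule hom_ordered_prod[OF \<pi> derived_quot_is_comm_group that])
  show ?thesis
  proof (rule homI)
    fix x assume "x \<in> carrier (cyclic_wreath G n)"
    then show "wreath_prod_class G n x \<in> carrier ?A"
      unfolding wreath_prod_class_def
      by (intro \<pi>_closed ordered_prod_closed) (auto simp: cyclic_wreath_carrier)
  next
    fix x y assume xy: "x \<in> carrier (cyclic_wreath G n)" "y \<in> carrier (cyclic_wreath G n)"
    obtain a k b p where [simp]: "x = (a, k)" "y = (b, p)" by (metis surj_pair)
    let ?s = "\<lambda>i. cyclic_index n (int i + p)"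
    have a: "a i \<in> carrier G" and b: "b i \<in> carrier G" if "i \<in> {1..n}" for i
      using xy that by (auto simp: cyclic_wreath_carrier)
    have s: "?s i \<in> {1..n}" for i by (rule cyclic_index_in[OF n])
    let ?c = "\<lambda>i\<in>{1..n}. a (?s i) \<otimes> b i"
    have "?\<pi> (ordered_prod G n ?c) = finprod ?A (\<lambda>i. ?\<pi> (?c i)) {1..n}"
      by (rule prod) (use a b s in auto)
    also have "\<dots> = finprod ?A (\<lambda>i. ?\<pi> (a (?s i)) \<otimes>\<^bsub>?A\<^esub> ?\<pi> (b i)) {1..n}"
      by (rule A.finprod_cong')
        (use a b s \<pi>_closed in \<open>auto simp: hom_mult[OF \<pi>] simp del: atLeastAtMost_iff mult_FactGroup\<close>)
    also have "\<dots> = finprod ?A (\<lambda>i. ?\<pi> (a (?s i))) {1..n} \<otimes>\<^bsub>?A\<^esub> finprod ?A (\<lambda>i. ?\<pi> (b i)) {1..n}"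
      by (rule A.finprod_multf) (use a b s \<pi>_closed in blast)+
    also have "finprod ?A (\<lambda>i. ?\<pi> (a (?s i))) {1..n} = finprod ?A (\<lambda>i. ?\<pi> (a i)) (?s ` {1..n})"
      by (rule A.finprod_reindex[symmetric])
        (use a s \<pi>_closed bij_betw_cyclic_index[OF n, of p] in \<open>auto simp: bij_betw_def\<close>)
    also have "?s ` {1..n} = {1..n}"
      using bij_betw_cyclic_index[OF n, of p] by (simp add: bij_betw_def)
    also have "finprod ?A (\<lambda>i. ?\<pi> (a i)) {1..n} = ?\<pi> (ordered_prod G n a)"
      by (rule prod[symmetric]) (use a in blast)
    also have "finprod ?A (\<lambda>i. ?\<pi> (b i)) {1..n} = ?\<pi> (ordered_prod G n b)"
      by (rule prod[symmetric]) (use b in blast)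
    finally show "wreath_prod_class G n (x \<otimes>\<^bsub>cyclic_wreath G n\<^esub> y) =
        wreath_prod_class G n x \<otimes>\<^bsub>?A\<^esub> wreath_prod_class G n y"
      by (simp only: wreath_prod_class_def cyclic_wreath_mult fst_conv \<open>x = (a, k)\<close> \<open>y = (b, p)\<close>)
  qed
qed

lemma snd_hom_cyclic_wreath: "snd \<in> hom (cyclic_wreath G n) integer_group"
  by (auto simp: hom_def cyclic_wreath_mult)

definition wreath_single ::
  "('a, 'b) monoid_scheme \<Rightarrow> nat \<Rightarrow> nat \<Rightarrow> 'a \<Rightarrow> (nat \<Rightarrow> 'a) \<times> int" where
  "wreath_single G n i x = (\<lambda>j\<in>{1..n}. if j = i then x else \<one>\<^bsub>G\<^esub>, 0)"

text \<open>Only the integer component of the right factor shifts anything, so for 0 the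
  multiplication is coordinatewise.\<close>

lemma cyclic_wreath_mult_0:
  "(a, k) \<otimes>\<^bsub>cyclic_wreath G n\<^esub> (b, 0) = (\<lambda>i\<in>{1..n}. a i \<otimes>\<^bsub>G\<^esub> b i, k)"
  by (simp add: cyclic_wreath_mult cyclic_index_id fun_eq_iff restrict_def)

lemma (in group) wreath_single_hom: "wreath_single G n i \<in> hom G (cyclic_wreath G n)"
  by (auto simp: hom_def wreath_single_def cyclic_wreath_carrier cyclic_wreath_mult_0 fun_eq_iff)

text \<open>Multiplying by \<open>t\<close> on the right makes coordinate \<open>j\<close> read the
  old entry at \<open>j + i - 1\<close>, so the entry \<open>x\<close> moves from \<open>i\<close>
  to 1. This is conjugation by \<open>t\<close>, written without inverses.\<close>

lemma (in group) wreath_single_shift: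
  assumes n: "n \<ge> 1" and i: "i \<in> {1..n}" and x: "x \<in> carrier G"
  defines "t \<equiv> (\<lambda>j\<in>{1..n}. \<one>, int i - 1)"
  shows "wreath_single G n i x \<otimes>\<^bsub>cyclic_wreath G n\<^esub> t = t \<otimes>\<^bsub>cyclic_wreath G n\<^esub> wreath_single G n 1 x"
proof -
  \<comment> \<open>The shift by \<open>i - 1\<close> sends 1 to \<open>i\<close> and is injective
    on \<open>{1..n}\<close>.\<close>
  have "cyclic_index n (int j + (int i - 1)) = i \<longleftrightarrow> j = 1" if "j \<in> {1..n}" for j
    using inj_on_eq_iff[OF bij_betw_imp_inj_on[OF bij_betw_cyclic_index[OF n, of "int i - 1"]] that, of 1]
      cyclic_index_id[OF i] n by simp
  then show ?thesis
    using cyclic_index_in[OF n] x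
    by (auto simp: t_def wreath_single_def cyclic_wreath_mult_0 cyclic_wreath_mult fun_eq_iff
        simp del: atLeastAtMost_iff)
qed

text \<open>The element \<open>(g, 0)\<close> is the product of its single-coordinate parts, and
  their order does not matter in \<open>A\<close>.\<close>

lemma (in group) hom_wreath_eq_finprod:
  assumes h: "h \<in> hom (cyclic_wreath G n) A" and "comm_group A" and n: "n \<ge> 1"
    and g: "g \<in> {1..n} \<rightarrow>\<^sub>E carrier G"
  shows "h (g, 0) = finprod A (\<lambda>i. h (wreath_single G n i (g i))) {1..n}"
proof -
  interpret A: comm_group A by fact
  interpret W: group "cyclic_wreath G n" by (rule group_cyclic_wreath[OF is_group n])
  interpret group_hom "cyclic_wreath G n" A h
    using h by unfold_locales
  let ?W = "cyclic_wreath G n"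
  \<comment> \<open>The restriction of \<open>g\<close> to \<open>S\<close>, filled up with units,
    leads from the identity at \<open>{}\<close> to \<open>(g, 0)\<close> at \<open>{1..n}\<close>
    by adding one coordinate at a time.\<close>
  define r where "r S = (\<lambda>j\<in>{1..n}. if j \<in> S then g j else \<one>, 0 :: int)" for S
  have r: "r S \<in> carrier ?W" for S
    using g by (auto simp: r_def cyclic_wreath_carrier)
  have e: "wreath_single G n i (g i) \<in> carrier ?W" if "i \<in> {1..n}" for i
    by (rule hom_in_carrier[OF wreath_single_hom]) (use g that in auto)
  have "h (r S) = finprod A (\<lambda>i. h (wreath_single G n i (g i))) S" if "finite S" "S \<subseteq> {1..n}" for S
    using that
  proof (induction S rule: finite_induct)
    case empty
    have "r {} = \<one>\<^bsub>?W\<^esub>" by (simp add: r_def cyclic_wreath_one)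
    then show ?case by simp
  next
    case (insert i S)
    have "r (insert i S) = wreath_single G n i (g i) \<otimes>\<^bsub>?W\<^esub> r S"
      using insert.hyps insert.prems g
      by (auto simp: PiE_iff r_def wreath_single_def cyclic_wreath_mult_0 fun_eq_iff)
    moreover have "(\<lambda>i. h (wreath_single G n i (g i))) \<in> S \<rightarrow> carrier A"
      using insert.prems e hom_closed by blast
    ultimately show ?case
      using insert e r by simp
  qed
  moreover have "r {1..n} = (g, 0)"
    using g by (auto simp: r_def fun_eq_iff PiE_iff extensional_def)
  ultimately show ?thesis by (metis finite_atLeastAtMost order_refl)
qed

text \<open>Conjugate elements have equal images in \<open>A\<close>, so all single-coordinate parts
  can be moved to coordinate 1, where they multiply as in \<open>G\<close>.\<close>

lemma (in group) hom_wreath_eq_ordered_prod: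
  assumes h: "h \<in> hom (cyclic_wreath G n) A" and A: "comm_group A" and n: "n \<ge> 1"
    and g: "g \<in> {1..n} \<rightarrow>\<^sub>E carrier G"
  shows "h (g, 0) = h (wreath_single G n 1 (ordered_prod G n g))"
proof -
  interpret A: comm_group A by fact
  interpret W: group "cyclic_wreath G n" by (rule group_cyclic_wreath[OF is_group n])
  interpret group_hom "cyclic_wreath G n" A h
    using h by unfold_locales
  let ?W = "cyclic_wreath G n"
  have e: "wreath_single G n i x \<in> carrier ?W" if "x \<in> carrier G" for i x
    by (rule hom_in_carrier[OF wreath_single_hom that])
  have move: "h (wreath_single G n i x) = h (wreath_single G n 1 x)"
    if i: "i \<in> {1..n}" and x: "x \<in> carrier G" for i x
  proof -
    let ?t = "(\<lambda>j\<in>{1..n}. \<one>, int i - 1)"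
    have t: "?t \<in> carrier ?W" by (simp add: cyclic_wreath_carrier)
    have "h (wreath_single G n i x) \<otimes>\<^bsub>A\<^esub> h ?t = h ?t \<otimes>\<^bsub>A\<^esub> h (wreath_single G n 1 x)"
      using arg_cong[OF wreath_single_shift[OF n i x], of h] e[OF x] t by simp
    \<comment> \<open>By commutativity of \<open>A\<close> the factor \<open>h ?t\<close>
      cancels.\<close>
    then show ?thesis
      using e[OF x] t by (metis A.m_comm A.right_cancel hom_closed)
  qed
  have hom1: "(\<lambda>x. h (wreath_single G n 1 x)) \<in> hom G A"
    using Group.hom_compose[OF wreath_single_hom h] by (simp add: comp_def)
  have "h (g, 0) = finprod A (\<lambda>i. h (wreath_single G n i (g i))) {1..n}"
    by (rule hom_wreath_eq_finprod[OF h A n g])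
  also have "\<dots> = finprod A (\<lambda>i. h (wreath_single G n 1 (g i))) {1..n}"
  proof (rule A.finprod_cong')
    show "(\<lambda>i. h (wreath_single G n 1 (g i))) \<in> {1..n} \<rightarrow> carrier A"
      using g e by (auto simp: PiE_iff)
    show "h (wreath_single G n i (g i)) = h (wreath_single G n 1 (g i))" if "i \<in> {1..n}" for i
      by (rule move[OF that]) (use g that in auto)
  qed simp
  \<comment> \<open>\<open>hom_ordered_prod\<close>, read backwards for the first-coordinate copy of
    \<open>G\<close>, collects the factors into one.\<close>
  also have "\<dots> = h (wreath_single G n 1 (ordered_prod G n g))"
    by (rule hom_ordered_prod[OF hom1 A, symmetric]) (use g in auto)
  finally show ?thesis .
qed

theorem theorem3p1:
  fixes G :: "('a, 'b) monoid_scheme" and n :: nat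
  assumes "group G" and "n \<ge> 1"
  shows "commutator_subgroup (cyclic_wreath G n) =
    {(g, 0) | g. g \<in> carrier (power_group G n) \<and> ordered_prod G n g \<in> commutator_subgroup G}"
proof -
  interpret G: group G by fact
  let ?W = "cyclic_wreath G n"
  interpret W: group ?W by (rule group_cyclic_wreath[OF assms])
  show ?thesis
  proof (intro equalityI subsetI)
    fix x assume x: "x \<in> commutator_subgroup ?W"
    obtain g k where xgk: "x = (g, k)" by (cases x)
    have "x \<in> carrier ?W"
      using x W.derived_in_carrier[of "carrier ?W"] by blast
    then have g: "g \<in> {1..n} \<rightarrow>\<^sub>E carrier G"
      by (simp add: xgk cyclic_wreath_carrier)
    have "k = 0"
      using W.hom_comm_group_derived[OF snd_hom_cyclic_wreath _ x] abelian_integer_group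
      by (simp add: xgk)
    moreover have "derived G (carrier G) #>\<^bsub>G\<^esub> ordered_prod G n g = \<one>\<^bsub>G Mod derived G (carrier G)\<^esub>"
      using W.hom_comm_group_derived[OF G.wreath_prod_class_hom[OF assms(2)]
          G.derived_quot_is_comm_group x]
      by (simp add: wreath_prod_class_def xgk)
    then have "ordered_prod G n g \<in> commutator_subgroup G"
      using G.coset_derived_eq_one_iff G.ordered_prod_closed[of g n] g by blast
    ultimately show "x \<in> {(g, 0) | g. g \<in> carrier (power_group G n) \<and>
        ordered_prod G n g \<in> commutator_subgroup G}"
      using g xgk by simp
  next
    fix x assume "x \<in> {(g, 0 :: int) | g. g \<in> carrier (power_group G n) \<and>
        ordered_prod G n g \<in> commutator_subgroup G}"
    then obtain g where x: "x = (g, 0)" and g: "g \<in> {1..n} \<rightarrow>\<^sub>E carrier G"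
      and prod: "ordered_prod G n g \<in> commutator_subgroup G"
      by auto
    \<comment> \<open>The commutative target is now the abelianization of the wreath product itself,
      where a trivial image means membership in the commutator subgroup.\<close>
    let ?Q = "?W Mod derived ?W (carrier ?W)"
    let ?\<rho> = "\<lambda>w. derived ?W (carrier ?W) #>\<^bsub>?W\<^esub> w"
    have \<rho>: "?\<rho> \<in> hom ?W ?Q"
      by (rule normal.r_coset_hom_Mod[OF W.derived_self_is_normal])
    have "(\<lambda>y. ?\<rho> (wreath_single G n 1 y)) \<in> hom G ?Q"
      using Group.hom_compose[OF G.wreath_single_hom \<rho>] by (simp add: comp_def)
    then have "?\<rho> (wreath_single G n 1 (ordered_prod G n g)) = \<one>\<^bsub>?Q\<^esub>"
      using G.hom_comm_group_derived W.derived_quot_is_comm_group prod by blast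
    then have "?\<rho> (g, 0) = \<one>\<^bsub>?Q\<^esub>"
      using G.hom_wreath_eq_ordered_prod[OF \<rho> W.derived_quot_is_comm_group assms(2) g] by simp
    then show "x \<in> commutator_subgroup ?W"
      using W.coset_derived_eq_one_iff[of "(g, 0)"] g x by (simp add: cyclic_wreath_carrier)
  qed
qed

end
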